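(* Let $U$ be a unitary representation of $\mathbb{R}^n$, without (nonzero) invariant vectors, on a separable Hilbert space $H$. Let $p:[0,1]\to\mathbb{R}^n$ be a polynomial curve which is not contained in a proper affine subspace of $\mathbb{R}^n$. For $\lambda>0$ and $x\in H$ define the Bochner integral $$x_\lambda=\int_0^1 U_{\lambda p(t)}x\,dt .$$ Then for every $x\in H$, $x_\lambda\to 0$ in the norm topology of $H$ as $\lambda\to\infty$.
   Context: A unitary representation of $\mathbb{R}^n$ is understood, as usual, to be strongly continuous. A polynomial curve in $\mathbb{R}^n$ is a map $p(t)=(p_1(t),\dots,p_n(t))$ all of whose coordinates are real polynomials in $t$. *)

theory Defs
  imports "HOL-Analysis.Analysis" "HOL-Computational_Algebra.Polynomial"
begin

text \<open>
  Complex inner product spaces. The underlying real normed space is inherited, so that the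
  library's topology and Bochner integral apply; the axioms tie its real scalar multiplication
  and its norm to the complex structure. The inner product is conjugate-linear in its first
  argument.
\<close>

class complex_inner = real_normed_vector +
  fixes scaleC :: "complex \<Rightarrow> 'a \<Rightarrow> 'a" (infixr \<open>*\<^sub>C\<close> 75)
    and cinner :: "'a \<Rightarrow> 'a \<Rightarrow> complex"
  assumes scaleC_add_right: "a *\<^sub>C (x + y) = a *\<^sub>C x + a *\<^sub>C y"
    and scaleC_add_left: "(a + b) *\<^sub>C x = a *\<^sub>C x + b *\<^sub>C x"
    and scaleC_scaleC: "a *\<^sub>C b *\<^sub>C x = (a * b) *\<^sub>C x"
    and scaleR_scaleC: "r *\<^sub>R x = complex_of_real r *\<^sub>C x"
    and cinner_commute: "cinner x y = cnj (cinner y x)"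
    and cinner_add_left: "cinner (x + y) z = cinner x z + cinner y z"
    and cinner_scaleC_left: "cinner (a *\<^sub>C x) y = cnj a * cinner x y"
    and cinner_ge_zero: "0 \<le> Re (cinner x x)"
    and cinner_eq_zero_iff: "cinner x x = 0 \<longleftrightarrow> x = 0"
    and norm_eq_sqrt_cinner: "norm x = sqrt (Re (cinner x x))"

text \<open>
  Separability is expressed by the additional sort \<^class>\<open>second_countable_topology\<close>, to which it
  is equivalent for metric spaces.
\<close>

class chilbert_space = complex_inner + banach

instantiation complex :: chilbert_space
begin

definition scaleC_complex :: "complex \<Rightarrow> complex \<Rightarrow> complex"
  where "scaleC_complex a x = a * x"

definition cinner_complex :: "complex \<Rightarrow> complex \<Rightarrow> complex"
  where "cinner_complex x y = cnj x * y"

instance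
proof
  fix a b x y z :: complex and r :: real
  show "a *\<^sub>C (x + y) = a *\<^sub>C x + a *\<^sub>C y" "(a + b) *\<^sub>C x = a *\<^sub>C x + b *\<^sub>C x"
    "a *\<^sub>C b *\<^sub>C x = (a * b) *\<^sub>C x"
    by (simp_all add: scaleC_complex_def algebra_simps)
  show "r *\<^sub>R x = complex_of_real r *\<^sub>C x"
    by (simp add: scaleC_complex_def scaleR_conv_of_real)
  show "cinner x y = cnj (cinner y x)" "cinner (x + y) z = cinner x z + cinner y z"
    "cinner (a *\<^sub>C x) y = cnj a * cinner x y" "0 \<le> Re (cinner x x)"
    "cinner x x = 0 \<longleftrightarrow> x = 0"
    by (simp_all add: scaleC_complex_def cinner_complex_def algebra_simps)
  show "norm x = sqrt (Re (cinner x x))"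
    by (simp add: cinner_complex_def cmod_def power2_eq_square)
qed

end

definition clinear :: "('a::complex_inner \<Rightarrow> 'b::complex_inner) \<Rightarrow> bool"
  where "clinear T \<longleftrightarrow>
    (\<forall>x y. T (x + y) = T x + T y) \<and> (\<forall>a x. T (a *\<^sub>C x) = a *\<^sub>C T x)"

definition unitary_operator :: "('a::complex_inner \<Rightarrow> 'a) \<Rightarrow> bool"
  where "unitary_operator T \<longleftrightarrow>
    clinear T \<and> surj T \<and> (\<forall>x y. cinner (T x) (T y) = cinner x y)"

text \<open>
  Strongly continuous homomorphisms into the unitary group. The identity
  \<open>U 0 = id\<close> follows from the homomorphism property, since each operator is bijective.
\<close>

definition unitary_representation ::
    "('g::topological_group_add \<Rightarrow> 'a::complex_inner \<Rightarrow> 'a) \<Rightarrow> bool"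
  where "unitary_representation U \<longleftrightarrow>
    (\<forall>g. unitary_operator (U g)) \<and>
    (\<forall>g h. U (g + h) = U g \<circ> U h) \<and>
    (\<forall>x. continuous_on UNIV (\<lambda>g. U g x))"

definition invariant_vector :: "('g \<Rightarrow> 'a \<Rightarrow> 'a) \<Rightarrow> 'a \<Rightarrow> bool"
  where "invariant_vector U x \<longleftrightarrow> (\<forall>g. U g x = x)"

text \<open>Only the values of \<open>p\<close> on \<open>[0,1]\<close> are constrained.\<close>

definition polynomial_curve :: "(real \<Rightarrow> real ^ 'n) \<Rightarrow> bool"
  where "polynomial_curve p \<longleftrightarrow> (\<forall>i. \<exists>q :: real poly. \<forall>t\<in>{0..1}. p t $ i = poly q t)"

definition curve_average ::
    "(real ^ 'n \<Rightarrow> 'a \<Rightarrow> 'a) \<Rightarrow> (real \<Rightarrow> real ^ 'n) \<Rightarrow> real \<Rightarrow> 'a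
      \<Rightarrow> 'a::{banach, second_countable_topology}"
  where "curve_average U p s x = (LINT t:{0..1}|lborel. U (s *\<^sub>R p t) x)"

lemma continuous_on_polynomial_curve:
  assumes "polynomial_curve p"
  shows "continuous_on {0..1} p"
proof -
  have "continuous_on {0..1} (\<lambda>t. p t $ i)" for i
  proof -
    obtain q :: "real poly" where q: "\<forall>t\<in>{0..1}. p t $ i = poly q t"
      using assms unfolding polynomial_curve_def by blast
    have "continuous_on {0..1} (poly q)"
      by (intro continuous_intros)
    then show ?thesis
      by (rule continuous_on_eq) (simp add: q)
  qed
  then have "continuous_on {0..1} (\<lambda>t. \<chi> i. p t $ i)"
    by (rule continuous_on_vec_lambda)
  then show ?thesis
    by simp
qed

text \<open>The integrand of \<^const>\<open>curve_average\<close> is Bochner integrable in the intended situation.\<close>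

lemma curve_average_integrable:
  fixes U :: "real ^ 'n \<Rightarrow> 'a \<Rightarrow> 'a::{chilbert_space, second_countable_topology}"
  assumes "unitary_representation U" and "polynomial_curve p"
  shows "set_integrable lborel {0..1} (\<lambda>t. U (s *\<^sub>R p t) x)"
proof -
  have U: "continuous_on UNIV (\<lambda>g. U g x)"
    using assms(1) by (simp add: unitary_representation_def)
  have "continuous_on {0..1} (\<lambda>t. s *\<^sub>R p t)"
    by (intro continuous_intros continuous_on_polynomial_curve assms(2))
  then have "continuous_on {0..1} (\<lambda>t. U (s *\<^sub>R p t) x)"
    by (rule continuous_on_compose2[OF U]) simp
  then show ?thesis
    unfolding set_integrable_def by (rule borel_integrable_compact[OF compact_Icc])
qed

end

theory Submission
  imports Defs
begin

text \<open>
  The vectors \<open>x\<close> with \<open>x\<^sub>\<lambda> \<rightarrow> 0\<close> form a closed subspace \<open>G\<close>. Write \<open>p t = (\<Sum>k\<le>D. t ^ k c\<^sub>k)\<close>.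
  If \<open>z\<close> is orthogonal to \<open>G\<close>, then \<open>z\<close> is fixed by every \<open>U (s c\<^sub>k)\<close> with \<open>k \<ge> 1\<close>, by downward
  induction on \<open>k\<close>: the higher coefficients act trivially on the coboundary \<open>U (s c\<^sub>k) z - z\<close>, so
  its averages are taken along a curve with leading coefficient \<open>c\<^sub>k\<close> and tend to \<open>0\<close>
  by Weyl differencing. Hence the coboundary lies in \<open>G\<close>, is orthogonal to \<open>z\<close>, and
  vanishes because \<open>U (s c\<^sub>k)\<close> is isometric. Since the \<open>c\<^sub>k\<close> with \<open>k \<ge> 1\<close> span, \<open>z\<close> is invariant.
\<close>

section \<open>The real inner product\<close>

text \<open>The real part is what the norm of a difference sees, and it is real bilinear, so
  \<open>subspace\<close> and \<open>bounded_linear\<close> apply. Orthogonality in this weaker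
  sense is all that the argument uses.\<close>

definition rinner :: "'a::complex_inner \<Rightarrow> 'a \<Rightarrow> real"
  where "rinner x y = Re (cinner x y)"

lemma rinner_commute: "rinner x y = rinner y x"
  unfolding rinner_def by (subst cinner_commute) simp

lemma rinner_add_left: "rinner (x + y) z = rinner x z + rinner y z"
  by (simp add: rinner_def cinner_add_left)

lemma rinner_scaleR_left: "rinner (r *\<^sub>R x) y = r * rinner x y"
  by (simp add: rinner_def scaleR_scaleC cinner_scaleC_left)

lemma rinner_add_right: "rinner z (x + y) = rinner z x + rinner z y"
  by (metis rinner_add_left rinner_commute)

lemma rinner_scaleR_right: "rinner y (r *\<^sub>R x) = r * rinner y x"
  by (metis rinner_scaleR_left rinner_commute)

lemma rinner_diff_left: "rinner (x - y) z = rinner x z - rinner y z"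
  using rinner_add_left[of "x - y" y z] by simp

lemma rinner_diff_right: "rinner z (x - y) = rinner z x - rinner z y"
  by (metis rinner_diff_left rinner_commute)

lemmas rinner_simps = rinner_add_left rinner_add_right rinner_diff_left rinner_diff_right
  rinner_scaleR_left rinner_scaleR_right

lemma rinner_self: "rinner x x = (norm x)\<^sup>2"
  by (simp add: rinner_def norm_eq_sqrt_cinner cinner_ge_zero)

lemma norm_diff_square:
  "(norm (x - y))\<^sup>2 = (norm x)\<^sup>2 - 2 * rinner x y + (norm (y::'a::complex_inner))\<^sup>2"
  unfolding rinner_self[symmetric] by (simp add: rinner_simps rinner_commute[of y x])

text \<open>Cauchy-Schwarz: subtracting from \<open>x\<close> its projection onto \<open>y\<close>
  leaves a vector whose squared norm is nonnegative.\<close>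

lemma abs_rinner_le: "\<bar>rinner x y\<bar> \<le> norm x * norm (y::'a::complex_inner)"
proof (cases "y = 0")
  case True
  then show ?thesis using rinner_scaleR_right[of x 0 y] by simp
next
  case False
  define r where "r = rinner x y / (norm y)\<^sup>2"
  have "0 \<le> (norm (x - r *\<^sub>R y))\<^sup>2" by simp
  also have "\<dots> = (norm x)\<^sup>2 - (rinner x y)\<^sup>2 / (norm y)\<^sup>2"
    using False unfolding norm_diff_square
    by (simp add: rinner_simps r_def power2_eq_square field_simps)
  finally have "(rinner x y)\<^sup>2 \<le> (norm x * norm y)\<^sup>2"
    using False by (simp add: field_simps power_mult_distrib)
  then show ?thesis
    by (simp add: abs_le_square_iff[symmetric])
qed

lemma bounded_linear_rinner_left: "bounded_linear (\<lambda>v. rinner v z)"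
  by (rule bounded_linear_intro[where K = "norm z"]) (simp_all add: rinner_simps abs_rinner_le)

lemma bounded_linear_rinner_right: "bounded_linear (\<lambda>v. rinner z v)"
  using bounded_linear_rinner_left[of z] by (simp add: rinner_commute)

section \<open>Nearest points and orthogonal vectors for closed subspaces\<close>

lemma parallelogram_midpoint:
  fixes x u v :: "'a::complex_inner"
  shows "(norm (u - v))\<^sup>2
    = 2 * (norm (x - u))\<^sup>2 + 2 * (norm (x - v))\<^sup>2 - 4 * (norm (x - (1/2) *\<^sub>R (u + v)))\<^sup>2"
  unfolding rinner_self[symmetric]
  by (simp add: rinner_simps rinner_commute[of u x] rinner_commute[of v x] rinner_commute[of v u]
      algebra_simps)

text \<open>A minimizing sequence is Cauchy by the parallelogram law, because midpoints of its terms
  stay in \<open>G\<close> and so have distance at least \<open>d\<close> from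
  \<open>x\<close>.\<close>

lemma ex_nearest_point_subspace:
  fixes G :: "'a::chilbert_space set"
  assumes "closed G" and "subspace G"
  shows "\<exists>g\<in>G. \<forall>w\<in>G. norm (x - g) \<le> norm (x - w)"
proof -
  have ne: "G \<noteq> {}" using subspace_0[OF assms(2)] by auto
  define d where "d = infdist x G"
  have d0: "d \<ge> 0" by (simp add: d_def infdist_nonneg)
  have d_le: "d \<le> norm (x - w)" if "w \<in> G" for w
    using infdist_le[OF that, of x] by (simp add: d_def dist_norm)
  have "\<exists>w\<in>G. norm (x - w) < d + 1 / Suc n" for n
  proof -
    have "(INF a\<in>G. dist x a) < d + 1 / Suc n"
      using ne by (simp add: d_def infdist_notempty)
    then show ?thesis
      using ne by (subst (asm) cINF_less_iff) (auto simp: dist_norm intro: bdd_belowI2[of _ 0])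
  qed
  then obtain g where gG: "\<And>n. g n \<in> G" and gd: "\<And>n. norm (x - g n) < d + 1 / Suc n"
    by metis
  have lim: "(\<lambda>n. norm (x - g n)) \<longlonglongrightarrow> d"
  proof (rule tendsto_sandwich[where f = "\<lambda>_. d" and h = "\<lambda>n. d + 1 / Suc n"])
    show "(\<lambda>n. d + 1 / Suc n) \<longlonglongrightarrow> d"
      using tendsto_add[OF tendsto_const LIMSEQ_inverse_real_of_nat, of d]
      by (simp add: inverse_eq_divide)
    show "\<forall>\<^sub>F n in sequentially. d \<le> norm (x - g n)"
      by (simp add: d_le gG)
    show "\<forall>\<^sub>F n in sequentially. norm (x - g n) \<le> d + 1 / Suc n"
      by (intro always_eventually allI less_imp_le gd)
  qed simp
  have "Cauchy g"
  proof (rule metric_CauchyI)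
    fix e :: real
    assume e: "e > 0"
    have "(\<lambda>n. (norm (x - g n))\<^sup>2) \<longlonglongrightarrow> d\<^sup>2"
      by (intro tendsto_intros lim)
    \<comment> \<open>The slack \<open>e\<^sup>2 / 4\<close> fits the parallelogram law: the two
      bounds contribute \<open>4 * d\<^sup>2 + e\<^sup>2\<close>, and the midpoint takes away at
      least \<open>4 * d\<^sup>2\<close>.\<close>
    then have "\<forall>\<^sub>F n in sequentially. (norm (x - g n))\<^sup>2 < d\<^sup>2 + e\<^sup>2 / 4"
      by (rule order_tendstoD) (use e in simp)
    then obtain N where N: "\<And>n. n \<ge> N \<Longrightarrow> (norm (x - g n))\<^sup>2 < d\<^sup>2 + e\<^sup>2 / 4"
      unfolding eventually_sequentially by blast
    have "dist (g m) (g n) < e" if "m \<ge> N" "n \<ge> N" for m n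
    proof -
      have "(1/2) *\<^sub>R (g m + g n) \<in> G"
        by (intro subspace_scale subspace_add assms gG)
      then have "d\<^sup>2 \<le> (norm (x - (1/2) *\<^sub>R (g m + g n)))\<^sup>2"
        by (intro power_mono d_le d0)
      then have "(norm (g m - g n))\<^sup>2 < e\<^sup>2"
        using N[OF that(1)] N[OF that(2)] parallelogram_midpoint[of "g m" "g n" x] by linarith
      then show ?thesis
        using e by (simp add: dist_norm power2_less_imp_less)
    qed
    then show "\<exists>M. \<forall>m\<ge>M. \<forall>n\<ge>M. dist (g m) (g n) < e" by blast
  qed
  then obtain g' where g': "g \<longlonglongrightarrow> g'"
    using Cauchy_convergent convergent_def by blast
  have "g' \<in> G"
    using closed_sequentially[OF assms(1) gG g'] by simp
  moreover have "norm (x - g') = d"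
    by (rule LIMSEQ_unique[OF _ lim]) (intro tendsto_intros g')
  ultimately show ?thesis using d_le by auto
qed

text \<open>The difference between a point outside \<open>G\<close> and its nearest point in
  \<open>G\<close> cannot be shortened by subtracting multiples of any \<open>w\<close> in
  \<open>G\<close>.\<close>

lemma ex_orthogonal_vector:
  fixes G :: "'a::chilbert_space set"
  assumes "closed G" and "subspace G" and "G \<noteq> UNIV"
  shows "\<exists>z. z \<noteq> 0 \<and> (\<forall>w\<in>G. rinner w z = 0)"
proof -
  obtain x where x: "x \<notin> G" using assms(3) by blast
  obtain g where g: "g \<in> G" and min: "\<And>w. w \<in> G \<Longrightarrow> norm (x - g) \<le> norm (x - w)"
    using ex_nearest_point_subspace[OF assms(1,2)] by blast
  define z where "z = x - g"
  have "rinner w z = 0" if w: "w \<in> G" for w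
  proof (cases "w = 0")
    case True
    then show ?thesis using rinner_scaleR_left[of 0 w z] by simp
  next
    case False
    \<comment> \<open>This multiple of \<open>w\<close> minimizes
      \<open>norm (z - r *\<^sub>R w)\<close>.\<close>
    define r where "r = rinner w z / (norm w)\<^sup>2"
    have "g + r *\<^sub>R w \<in> G"
      by (intro subspace_add subspace_scale assms g w)
    from min[OF this] have "(norm z)\<^sup>2 \<le> (norm (z - r *\<^sub>R w))\<^sup>2"
      by (simp add: z_def diff_diff_eq)
    also have "\<dots> = (norm z)\<^sup>2 - (rinner w z)\<^sup>2 / (norm w)\<^sup>2"
      using False unfolding norm_diff_square
      by (simp add: rinner_simps r_def power2_eq_square field_simps rinner_commute[of z w])
    finally have "(rinner w z)\<^sup>2 / (norm w)\<^sup>2 \<le> 0" by simp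
    then show ?thesis
      using False by (simp add: divide_le_0_iff)
  qed
  moreover have "z \<noteq> 0" using x g by (auto simp: z_def)
  ultimately show ?thesis by blast
qed

section \<open>Integrals over an interval\<close>

lemma measure_lborel_min_max: "measure lborel {min u v..max u v} = \<bar>v - u\<bar>" for u v :: real
proof (cases "u \<le> v")
  case True
  then have *: "min u v = u" "max u v = v" by auto
  show ?thesis using True unfolding * by simp
next
  case False
  then have *: "min u v = v" "max u v = u" by auto
  show ?thesis using False unfolding * by simp
qed

text \<open>A translation of the integrand is a translation of the interval. The two intervals
  differ only near their endpoints, on a set covered by two intervals of length
  \<open>\<bar>e\<bar>\<close>.\<close>

lemma norm_integral_translate_diff_le:
  fixes f :: "real \<Rightarrow> 'a::{banach, second_countable_topology}"
  assumes f: "continuous_on UNIV f" and M: "\<And>t. norm (f t) \<le> M"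
  shows "norm (LINT t:{a..b}|lborel. f (t + e) - f t) \<le> 2 * \<bar>e\<bar> * M"
proof -
  have int: "set_integrable lborel {u..v} f" for u v
    by (intro borel_integrable_atLeastAtMost' continuous_on_subset[OF f]) simp
  have cont: "continuous_on {a..b} (\<lambda>t. f (t + e))"
    by (rule continuous_on_compose2[OF f]) (intro continuous_intros, simp)
  have "(LINT t:{a..b}|lborel. f (t + e))
      = (LINT t|lborel. indicator {a+e..b+e} (e + 1 * t) *\<^sub>R f (e + 1 * t))"
    unfolding set_lebesgue_integral_def
    by (intro Bochner_Integration.integral_cong) (auto simp: indicator_def add.commute)
  also have "\<dots> = (LINT t:{a+e..b+e}|lborel. f t)"
    unfolding set_lebesgue_integral_def
    using lborel_integral_real_affine[of 1 "\<lambda>t. indicator {a+e..b+e} t *\<^sub>R f t" e] by simp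
  finally have "(LINT t:{a..b}|lborel. f (t + e) - f t)
      = (LINT t:{a+e..b+e}|lborel. f t) - (LINT t:{a..b}|lborel. f t)"
    by (subst set_integral_diff(2)) (auto intro: int borel_integrable_atLeastAtMost' cont)
  also have "\<dots> = (LINT t|lborel. indicator {a+e..b+e} t *\<^sub>R f t - indicator {a..b} t *\<^sub>R f t)"
    using int unfolding set_lebesgue_integral_def set_integrable_def
    by (subst Bochner_Integration.integral_diff) auto
  finally have "norm (LINT t:{a..b}|lborel. f (t + e) - f t)
      = norm (LINT t|lborel. indicator {a+e..b+e} t *\<^sub>R f t - indicator {a..b} t *\<^sub>R f t)"
    by (rule arg_cong)
  also have "\<dots> \<le> (LINT t|lborel.
      M * indicator {min a (a+e)..max a (a+e)} t + M * indicator {min b (b+e)..max b (b+e)} t)"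
  proof (rule Bochner_Integration.integral_norm_bound_integral)
    show "integrable lborel (\<lambda>t. indicator {a+e..b+e} t *\<^sub>R f t - indicator {a..b} t *\<^sub>R f t)"
      using int unfolding set_integrable_def by auto
    show "integrable lborel (\<lambda>t. M * indicator {min a (a+e)..max a (a+e)} t
        + M * indicator {min b (b+e)..max b (b+e)} t)"
      by (intro Bochner_Integration.integrable_add integrable_mult_right integrable_real_indicator
          emeasure_bounded_finite) simp_all
    fix t
    have "0 \<le> M" by (rule order_trans[OF norm_ge_zero M])
    show "norm (indicator {a+e..b+e} t *\<^sub>R f t - indicator {a..b} t *\<^sub>R f t)
        \<le> M * indicator {min a (a+e)..max a (a+e)} t
          + M * indicator {min b (b+e)..max b (b+e)} t"
    proof (cases "t \<in> {a+e..b+e} \<longleftrightarrow> t \<in> {a..b}")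
      case True
      then have "indicator {a+e..b+e} t = (indicator {a..b} t :: real)"
        by (simp only: indicator_def)
      then show ?thesis using \<open>0 \<le> M\<close> by simp
    next
      case False
      then have "norm (indicator {a+e..b+e} t *\<^sub>R f t - indicator {a..b} t *\<^sub>R f t) \<le> M"
        using M[of t] by (cases "t \<in> {a..b}") (simp_all del: atLeastAtMost_iff)
      \<comment> \<open>Since \<open>t\<close> lies in exactly one of the two intervals, it lies
        between \<open>a\<close> or \<open>b\<close> and the translate of that endpoint;
        \<open>min\<close> and \<open>max\<close> cover both signs of \<open>e\<close>.\<close>
      moreover have "t \<in> {min a (a+e)..max a (a+e)} \<or> t \<in> {min b (b+e)..max b (b+e)}"
        using False by (auto simp: min_le_iff_disj le_max_iff_disj)
      ultimately show ?thesis
        using \<open>0 \<le> M\<close> by (elim disjE) (simp_all add: indicator_def del: atLeastAtMost_iff)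
    qed
  qed
  also have "\<dots> = M * \<bar>e\<bar> + M * \<bar>e\<bar>"
  proof -
    have "integrable lborel (\<lambda>t. M * indicator {min u v..max u v} t)" for u v :: real
      by (intro integrable_mult_right integrable_real_indicator emeasure_bounded_finite) simp_all
    moreover have "(LINT t|lborel. M * indicator {min u v..max u v} t) = M * \<bar>v - u\<bar>" for u v :: real
      by (simp only: integral_mult_right_zero Bochner_Integration.integral_indicator
          measure_lborel_min_max space_lborel space_borel Int_UNIV_right)
    ultimately show ?thesis
      by (simp only: Bochner_Integration.integral_add add_diff_cancel_left')
  qed
  finally show ?thesis by (simp add: algebra_simps)
qed

text \<open>The square is a double integral of inner products at times \<open>t\<close> and
  \<open>s\<close>; substitute \<open>s = t + h\<close> and exchange the integrals by Fubini. The
  second claim supplies the measurability in \<open>h\<close> needed for dominated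
  convergence.\<close>

lemma norm_integral_square:
  fixes f :: "real \<Rightarrow> 'a::{chilbert_space, second_countable_topology}"
  assumes f: "continuous_on UNIV f"
  shows "(norm (LINT t:{a..b}|lborel. f t))\<^sup>2
    = (LINT h|lborel. (LINT t:{max a (a-h)..min b (b-h)}|lborel. rinner (f t) (f (t + h))))"
    and "integrable lborel
      (\<lambda>h. LINT t:{max a (a-h)..min b (b-h)}|lborel. rinner (f t) (f (t + h)))"
proof -
  have int: "set_integrable lborel {a..b} f"
    by (intro borel_integrable_atLeastAtMost' continuous_on_subset[OF f]) simp
  define I where "I = (LINT t:{a..b}|lborel. f t)"
  \<comment> \<open>The square of side \<open>{a..b}\<close> in the coordinates time and shift; its
    slice at a fixed shift \<open>h\<close> is the interval in the statement.\<close>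
  define S where "S = {(t, h). a \<le> t \<and> t \<le> b \<and> a \<le> t + h \<and> t + h \<le> b}"
  define F where "F = (\<lambda>z. indicator S z *\<^sub>R rinner (f (fst z)) (f (fst z + snd z)))"
  have comp: "compact S"
  proof (rule compact_eq_bounded_closed[THEN iffD2], intro conjI)
    have "S \<subseteq> {a..b} \<times> {a-b..b-a}" by (auto simp: S_def)
    then show "bounded S"
      by (rule bounded_subset[rotated]) (intro bounded_Times bounded_closed_interval)
    show "closed S"
      unfolding S_def case_prod_beta by (intro closed_Collect_conj closed_Collect_le continuous_intros)
  qed
  have cont: "continuous_on S (\<lambda>z. f (fst z))" "continuous_on S (\<lambda>z. f (fst z + snd z))"
    by (rule continuous_on_compose2[OF f]; auto intro!: continuous_intros)+
  \<comment> \<open>Polarization reduces continuity of the inner product to continuity of the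
    norm.\<close>
  have "rinner u v = ((norm u)\<^sup>2 + (norm v)\<^sup>2 - (norm (u - v))\<^sup>2) / 2" for u v :: 'a
    by (simp add: norm_diff_square)
  then have "continuous_on S (\<lambda>z. rinner (f (fst z)) (f (fst z + snd z)))"
    by (simp only:) (intro continuous_intros cont, simp)
  then have "integrable lborel (\<lambda>z. indicator S z *\<^sub>R rinner (f (fst z)) (f (fst z + snd z)))"
    by (rule borel_integrable_compact[OF comp])
  then have F: "integrable (lborel \<Otimes>\<^sub>M lborel) F"
    by (simp only: lborel_prod F_def)
  have "(norm I)\<^sup>2 = rinner I I" by (simp add: rinner_self)
  also have "\<dots> = (LINT t:{a..b}|lborel. rinner (f t) I)"
    using integral_bounded_linear[OF bounded_linear_rinner_left,
        of lborel "\<lambda>t. indicator {a..b} t *\<^sub>R f t" I] int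
    by (simp add: I_def set_lebesgue_integral_def set_integrable_def rinner_simps)
  also have "\<dots> = (LINT t|lborel. LINT h|lborel. F (t, h))"
    unfolding set_lebesgue_integral_def
  proof (rule Bochner_Integration.integral_cong[OF refl])
    fix t :: real
    have "rinner (f t) I = (LINT s|lborel. indicator {a..b} s * rinner (f t) (f s))"
      using integral_bounded_linear[OF bounded_linear_rinner_right,
          of lborel "\<lambda>s. indicator {a..b} s *\<^sub>R f s" "f t"] int
      by (simp add: I_def set_lebesgue_integral_def set_integrable_def rinner_simps)
    also have "\<dots> = (LINT h|lborel. indicator {a..b} (t + h) * rinner (f t) (f (t + h)))"
      using lborel_integral_real_affine[of 1 "\<lambda>s. indicator {a..b} s * rinner (f t) (f s)" t]
      by simp
    finally have "indicator {a..b} t *\<^sub>R rinner (f t) I =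
        (LINT h|lborel. indicator {a..b} t * (indicator {a..b} (t + h) * rinner (f t) (f (t + h))))"
      by simp
    also have "\<dots> = (LINT h|lborel. F (t, h))"
      by (intro Bochner_Integration.integral_cong) (auto simp: F_def S_def indicator_def)
    finally show "indicator {a..b} t *\<^sub>R rinner (f t) I = (LINT h|lborel. F (t, h))" .
  qed
  also have "\<dots> = (LINT h|lborel. LINT t|lborel. F (t, h))"
    using lborel_pair.Fubini_integral[of "\<lambda>t h. F (t, h)"] F by simp
  finally have "(norm I)\<^sup>2 = (LINT h|lborel. LINT t|lborel. F (t, h))" .
  moreover have slice: "(LINT t|lborel. F (t, h))
      = ((LINT t:{max a (a-h)..min b (b-h)}|lborel. rinner (f t) (f (t + h))))" for h
    unfolding set_lebesgue_integral_def
    by (intro Bochner_Integration.integral_cong) (auto simp: F_def S_def indicator_def)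
  ultimately show "(norm (LINT t:{a..b}|lborel. f t))\<^sup>2
    = (LINT h|lborel. (LINT t:{max a (a-h)..min b (b-h)}|lborel. rinner (f t) (f (t + h))))"
    by (simp add: I_def)
  show "integrable lborel
      (\<lambda>h. LINT t:{max a (a-h)..min b (b-h)}|lborel. rinner (f t) (f (t + h)))"
    using lborel_pair.integrable_snd[of "\<lambda>t h. F (t, h)"] F by (simp add: slice)
qed

section \<open>Polynomial averages of a unitary representation\<close>

text \<open>Each \<open>t ^ k\<close> cancels in the binomial expansion. In degree \<open>d\<close>
  only the term \<open>k = Suc d\<close> survives, with binomial coefficient
  \<open>Suc d\<close>.\<close>

lemma poly_curve_difference:
  fixes c :: "nat \<Rightarrow> 'v::real_vector"
  obtains c' where "\<And>t. (\<Sum>k\<le>Suc d. (t + h) ^ k *\<^sub>R c k) - (\<Sum>k\<le>Suc d. t ^ k *\<^sub>R c k)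
      = (\<Sum>j\<le>d. t ^ j *\<^sub>R c' j)" and "c' d = (real (Suc d) * h) *\<^sub>R c (Suc d)"
proof
  \<comment> \<open>The guard \<open>j < k\<close> removes the top binomial term, the one cancelled
    by \<open>t ^ k\<close>.\<close>
  define c' where "c' j = (\<Sum>k\<le>Suc d. (if j < k then real (k choose j) * h ^ (k - j) else 0) *\<^sub>R c k)" for j
  have binom: "(t + h) ^ k - t ^ k
      = (\<Sum>j\<le>d. t ^ j * (if j < k then real (k choose j) * h ^ (k - j) else 0))"
    if "k \<le> Suc d" for t k
  proof -
    have "(t + h) ^ k - t ^ k = (\<Sum>j<k. real (k choose j) * t ^ j * h ^ (k - j))"
      unfolding binomial_ring by (simp add: lessThan_Suc_atMost[symmetric])
    also have "\<dots> = (\<Sum>j\<le>d. if j < k then real (k choose j) * t ^ j * h ^ (k - j) else 0)"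
      using that by (intro sum.mono_neutral_cong_left) auto
    finally show ?thesis by (auto simp: if_distrib mult_ac cong: if_cong)
  qed
  show "(\<Sum>k\<le>Suc d. (t + h) ^ k *\<^sub>R c k) - (\<Sum>k\<le>Suc d. t ^ k *\<^sub>R c k)
      = (\<Sum>j\<le>d. t ^ j *\<^sub>R c' j)" for t
  proof -
    have "(\<Sum>k\<le>Suc d. (t + h) ^ k *\<^sub>R c k) - (\<Sum>k\<le>Suc d. t ^ k *\<^sub>R c k)
        = (\<Sum>k\<le>Suc d. ((t + h) ^ k - t ^ k) *\<^sub>R c k)"
      by (simp only: sum_subtractf scaleR_diff_left)
    also have "\<dots> = (\<Sum>k\<le>Suc d. \<Sum>j\<le>d.
        (t ^ j * (if j < k then real (k choose j) * h ^ (k - j) else 0)) *\<^sub>R c k)"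
      by (intro sum.cong) (simp_all only: binom scaleR_sum_left atMost_iff)
    also have "\<dots> = (\<Sum>j\<le>d. t ^ j *\<^sub>R c' j)"
      unfolding c'_def scaleR_sum_right by (subst sum.swap) simp
    finally show ?thesis .
  qed
  have "(\<Sum>k\<le>d. (if d < k then real (k choose d) * h ^ (k - d) else 0) *\<^sub>R c k) = 0"
    by (intro sum.neutral) auto
  then show "c' d = (real (Suc d) * h) *\<^sub>R c (Suc d)"
    by (simp add: c'_def)
qed

section \<open>Elementary properties of a unitary representation\<close>

locale unitary_rep =
  fixes U :: "'v::real_normed_vector \<Rightarrow> 'h \<Rightarrow> 'h::{chilbert_space, second_countable_topology}"
  assumes rep: "unitary_representation U"
begin

lemma U_plus: "U (g + h) x = U g (U h x)"
  using rep by (simp add: unitary_representation_def)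

lemma U_add: "U g (x + y) = U g x + U g y"
  using rep by (simp add: unitary_representation_def unitary_operator_def clinear_def)

lemma U_scaleR: "U g (r *\<^sub>R x) = r *\<^sub>R U g x"
  using rep by (simp add: unitary_representation_def unitary_operator_def clinear_def scaleR_scaleC)

lemma U_diff: "U g (x - y) = U g x - U g y"
  using U_add[of g "x - y" y] by simp

lemma rinner_U: "rinner (U g x) (U g y) = rinner x y"
  using rep by (simp add: unitary_representation_def unitary_operator_def rinner_def)

lemma norm_U: "norm (U g x) = norm x"
  using rinner_U[of g x x] by (simp add: rinner_self)

text \<open>\<open>U 0\<close> is idempotent because \<open>0 + 0 = 0\<close>, and injective because
  it is isometric.\<close>

lemma U_zero: "U 0 x = x"
proof -
  have "U 0 (U 0 x - x) = 0"
    using U_plus[of 0 0 x] by (simp add: U_diff)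
  then show ?thesis
    using norm_U[of 0 "U 0 x - x"] by simp
qed

lemma U_commute: "U g (U h x) = U h (U g x)"
  by (metis U_plus add.commute)

lemma continuous_on_U:
  assumes "continuous_on S \<gamma>"
  shows "continuous_on S (\<lambda>t. U (\<gamma> t) x)"
  by (rule continuous_on_compose2[of UNIV "\<lambda>g. U g x", OF _ assms])
     (use rep in \<open>auto simp: unitary_representation_def\<close>)

lemma set_integrable_U:
  fixes a b :: real
  assumes "continuous_on {a..b} \<gamma>"
  shows "set_integrable lborel {a..b} (\<lambda>t. U (\<gamma> t) x)"
  by (rule borel_integrable_atLeastAtMost'[OF continuous_on_U[OF assms]])

lemma rinner_U_U: "rinner (U g x) (U h x) = rinner x (U (h - g) x)"
  using rinner_U[of g x "U (h - g) x"] by (simp add: U_plus[symmetric])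

lemma norm_integral_U_le:
  fixes a b :: real
  assumes "continuous_on {a..b} \<gamma>"
  shows "norm (LINT t:{a..b}|lborel. U (\<gamma> t) x) \<le> max 0 (b - a) * norm x"
proof -
  have "norm (LINT t:{a..b}|lborel. U (\<gamma> t) x) \<le> (LINT t|lborel. indicator {a..b} t * norm x)"
    unfolding set_lebesgue_integral_def
  proof (rule Bochner_Integration.integral_norm_bound_integral)
    show "integrable lborel (\<lambda>t. indicator {a..b} t *\<^sub>R U (\<gamma> t) x)"
      using set_integrable_U[OF assms] by (simp add: set_integrable_def)
    show "integrable lborel (\<lambda>t. indicator {a..b} t * norm x)"
      by (intro integrable_mult_left integrable_real_indicator) (simp_all add: emeasure_lborel_Icc_eq)
  qed (simp add: norm_U)
  then show ?thesis
    by (cases "a \<le> b") simp_all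
qed

text \<open>Directions whose entire line fixes \<open>z\<close>. Quantifying over \<open>s\<close>
  makes this a real subspace; a single time would only give a subgroup.\<close>

definition stab :: "'h \<Rightarrow> 'v set"
  where "stab z = {v. \<forall>s. U (s *\<^sub>R v) z = z}"

lemma subspace_stab: "subspace (stab z)"
  unfolding subspace_def stab_def
  by (auto simp: U_zero scaleR_add_right U_plus)

text \<open>
  Weyl differencing: the square of the average over a curve of degree \<open>d + 1\<close> is an integral,
  over shifts \<open>h\<close>, of averages over curves of degree \<open>d\<close> whose leading coefficient is a
  multiple of the original one, so that coboundaries stay coboundaries.
\<close>

lemma average_coboundary_tendsto_0:
  fixes c :: "nat \<Rightarrow> 'v"
  shows "((\<lambda>l. LINT t:{a..b}|lborel.
    U (l *\<^sub>R (\<Sum>k\<le>Suc d. t ^ k *\<^sub>R c k)) (U (s *\<^sub>R c (Suc d)) y - y)) \<longlongrightarrow> 0) at_top"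
proof (induction d arbitrary: c a b s)
  case 0
  define f where "f l t = U (l *\<^sub>R (c 0 + t *\<^sub>R c 1)) y" for l t
  \<comment> \<open>On a line, acting by \<open>s *\<^sub>R c 1\<close> amounts to a time shift by
    \<open>s / l\<close>. The coboundary average is then the effect of a translation, of order
    \<open>1 / l\<close>.\<close>
  have f: "U (l *\<^sub>R (\<Sum>k\<le>Suc 0. t ^ k *\<^sub>R c k)) (U (s *\<^sub>R c (Suc 0)) y - y)
      = f l (t + s / l) - f l t" if "l > 0" for l t
  proof -
    have "l *\<^sub>R (c 0 + t *\<^sub>R c 1) + s *\<^sub>R c 1 = l *\<^sub>R (c 0 + (t + s / l) *\<^sub>R c 1)"
      using that by (simp add: algebra_simps)
    then show ?thesis
      by (simp add: f_def U_diff flip: U_plus)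
  qed
  have "norm (LINT t:{a..b}|lborel.
      U (l *\<^sub>R (\<Sum>k\<le>Suc 0. t ^ k *\<^sub>R c k)) (U (s *\<^sub>R c (Suc 0)) y - y))
      \<le> 2 * \<bar>s / l\<bar> * norm y" if "l > 0" for l
    unfolding f[OF that]
    by (rule norm_integral_translate_diff_le)
       (auto simp: f_def norm_U intro!: continuous_on_U continuous_intros)
  then have "\<forall>\<^sub>F l in at_top. norm (LINT t:{a..b}|lborel.
      U (l *\<^sub>R (\<Sum>k\<le>Suc 0. t ^ k *\<^sub>R c k)) (U (s *\<^sub>R c (Suc 0)) y - y))
      \<le> 2 * \<bar>s / l\<bar> * norm y"
    using eventually_gt_at_top[of 0] by (rule eventually_mono[rotated]) blast
  moreover have "((\<lambda>l. 2 * \<bar>s / l\<bar> * norm y) \<longlongrightarrow> 0) at_top"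
    by (intro tendsto_mult_left_zero tendsto_mult_right_zero tendsto_rabs_zero
        tendsto_divide_0[OF tendsto_const] filterlim_at_top_imp_at_infinity filterlim_ident)
  ultimately show ?case
    by (rule Lim_null_comparison)
next
  case (Suc d)
  define x where "x = U (s *\<^sub>R c (Suc (Suc d))) y - y"
  define q where "q t = (\<Sum>k\<le>Suc (Suc d). t ^ k *\<^sub>R c k)" for t :: real
  have q: "continuous_on S q" for S
    unfolding q_def by (intro continuous_intros)
  define A where "A h = {max a (a - h)..min b (b - h)}" for h :: real
  \<comment> \<open>By unitarity, the inner product of the translates of \<open>x\<close> at times
    \<open>t\<close> and \<open>t + h\<close> depends only on \<open>q (t + h) - q t\<close>. Thus
    \<open>J l h\<close> pairs \<open>x\<close> with an average along a curve of lower degree, ready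
    for the induction hypothesis.\<close>
  define J where "J l h = rinner x (LINT t:A h|lborel. U (l *\<^sub>R (q (t + h) - q t)) x)" for l h
  have dq: "continuous_on S (\<lambda>t. l *\<^sub>R (q (t + h) - q t))" for S l h
    by (intro continuous_intros continuous_on_compose2[OF q[of UNIV]]) auto
  have J_eq: "(LINT t:A h|lborel. rinner (U (l *\<^sub>R q t) x) (U (l *\<^sub>R q (t + h)) x)) = J l h" for l h
    using integral_bounded_linear[OF bounded_linear_rinner_right,
        of lborel "\<lambda>t. indicator (A h) t *\<^sub>R U (l *\<^sub>R (q (t + h) - q t)) x" x]
      set_integrable_U[OF dq, of "max a (a - h)" "min b (b - h)" l h x]
    by (simp add: J_def A_def set_lebesgue_integral_def set_integrable_def rinner_simps rinner_U_U
        scaleR_diff_right)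
  have square: "(norm (LINT t:{a..b}|lborel. U (l *\<^sub>R q t) x))\<^sup>2 = (LINT h|lborel. J l h)" for l
    using norm_integral_square(1)[of "\<lambda>t. U (l *\<^sub>R q t) x" a b]
      continuous_on_U[OF continuous_on_scaleR[OF continuous_on_const q]]
    by (simp add: J_eq flip: A_def)
  have lim: "((\<lambda>l. J l h) \<longlongrightarrow> 0) at_top" if h: "h \<noteq> 0" for h
  proof -
    obtain c' where c': "\<And>t. q (t + h) - q t = (\<Sum>j\<le>Suc d. t ^ j *\<^sub>R c' j)"
      and lead: "c' (Suc d) = (real (Suc (Suc d)) * h) *\<^sub>R c (Suc (Suc d))"
      unfolding q_def by (rule poly_curve_difference[where d = "Suc d" and h = h and c = c]) blast
    \<comment> \<open>Compensates the factor gained by the leading coefficient, so that the same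
      vector \<open>x\<close> is a coboundary for the difference curve; this needs
      \<open>h \<noteq> 0\<close>.\<close>
    define s' where "s' = s / (real (Suc (Suc d)) * h)"
    have "s' *\<^sub>R c' (Suc d) = s *\<^sub>R c (Suc (Suc d))"
      unfolding lead s'_def using h by (simp del: of_nat_Suc)
    then have "((\<lambda>l. LINT t:A h|lborel. U (l *\<^sub>R (q (t + h) - q t)) x) \<longlongrightarrow> 0) at_top"
      using Suc.IH[of "max a (a - h)" "min b (b - h)" c' s'] by (simp only: A_def c' x_def)
    from bounded_linear.tendsto[OF bounded_linear_rinner_right this, of x]
    show ?thesis
      by (simp add: J_def rinner_scaleR_right[of _ 0, simplified])
  qed
  \<comment> \<open>Dominating function, independent of \<open>l\<close>: Cauchy-Schwarz and
    isometry bound \<open>J\<close>, and \<open>A h\<close> is empty for shifts longer than the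
    interval.\<close>
  have bound: "\<bar>J l h\<bar> \<le> norm x * (max 0 (b - a) * norm x) * indicator {-\<bar>b - a\<bar>..\<bar>b - a\<bar>} h" for l h
  proof (cases "h \<in> {-\<bar>b - a\<bar>..\<bar>b - a\<bar>}")
    case True
    have "norm (LINT t:A h|lborel. U (l *\<^sub>R (q (t + h) - q t)) x)
        \<le> max 0 (min b (b - h) - max a (a - h)) * norm x"
      unfolding A_def by (rule norm_integral_U_le[OF dq])
    also have "\<dots> \<le> max 0 (b - a) * norm x"
      by (intro mult_right_mono) auto
    finally have "norm x * norm (LINT t:A h|lborel. U (l *\<^sub>R (q (t + h) - q t)) x)
        \<le> norm x * (max 0 (b - a) * norm x)"
      by (rule mult_left_mono) simp
    then show ?thesis
      using abs_rinner_le[of x "LINT t:A h|lborel. U (l *\<^sub>R (q (t + h) - q t)) x"] True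
      by (simp add: J_def)
  next
    case False
    then have "A h = {}" by (auto simp: A_def)
    then show ?thesis
      using rinner_scaleR_right[of x 0 0] by (simp add: J_def set_lebesgue_integral_def)
  qed
  have J_meas: "J l \<in> borel_measurable lborel" for l
    using norm_integral_square(2)[of "\<lambda>t. U (l *\<^sub>R q t) x" a b]
      continuous_on_U[OF continuous_on_scaleR[OF continuous_on_const q]]
    by (intro borel_measurable_integrable) (simp add: J_eq flip: A_def)
  have "((\<lambda>l. LINT h|lborel. J l h) \<longlongrightarrow> integral\<^sup>L lborel (\<lambda>h::real. 0)) at_top"
  proof (rule integral_dominated_convergence_at_top[where s = J])
    \<comment> \<open>Pointwise convergence may fail only at the shift \<open>h = 0\<close>, a null
      set.\<close>
    show "AE h in lborel. ((\<lambda>l. J l h) \<longlongrightarrow> 0) at_top"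
      using AE_lborel_singleton[of 0] by eventually_elim (rule lim)
    show "integrable lborel
        (\<lambda>h. norm x * (max 0 (b - a) * norm x) * indicator {-\<bar>b - a\<bar>..\<bar>b - a\<bar>} h)"
      by (intro integrable_mult_right integrable_real_indicator) (auto simp: emeasure_lborel_Icc_eq)
    show "J l \<in> borel_measurable lborel" for l
      by (rule J_meas)
  qed (auto simp: bound)
  then have "((\<lambda>l. (norm (LINT t:{a..b}|lborel. U (l *\<^sub>R q t) x))\<^sup>2) \<longlongrightarrow> 0) at_top"
    by (simp add: square)
  from tendsto_real_sqrt[OF this]
  have "((\<lambda>l. norm (LINT t:{a..b}|lborel. U (l *\<^sub>R q t) x)) \<longlongrightarrow> 0) at_top"
    by simp
  then show ?case
    by (simp only: tendsto_norm_zero_iff q_def x_def)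
qed

text \<open>Truncation of the curve: its terms of degree above \<open>k\<close> add up to an element
  of \<open>stab x\<close>, which acts trivially on \<open>x\<close>. In the application
  \<open>x\<close> is a coboundary of \<open>z\<close>.\<close>

lemma fixed_by_stab_coefficients:
  assumes "\<And>v. v \<in> stab z \<Longrightarrow> v \<in> stab x"
    and "k \<le> D" and "\<And>j. k < j \<Longrightarrow> j \<le> D \<Longrightarrow> c j \<in> stab z"
  shows "U (l *\<^sub>R (\<Sum>j\<le>D. t ^ j *\<^sub>R c j)) x = U (l *\<^sub>R (\<Sum>j\<le>k. t ^ j *\<^sub>R c j)) x"
proof -
  have "(\<Sum>j\<in>{k<..D}. t ^ j *\<^sub>R c j) \<in> stab x"
    by (intro subspace_sum subspace_scale subspace_stab) (use assms in auto)
  then have "U (l *\<^sub>R (\<Sum>j\<in>{k<..D}. t ^ j *\<^sub>R c j)) x = x"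
    by (simp add: stab_def)
  moreover have "{..D} = {..k} \<union> {k<..D}" using assms(2) by auto
  then have "(\<Sum>j\<le>D. t ^ j *\<^sub>R c j)
      = (\<Sum>j\<le>k. t ^ j *\<^sub>R c j) + (\<Sum>j\<in>{k<..D}. t ^ j *\<^sub>R c j)"
    by (simp only:) (rule sum.union_disjoint, auto)
  ultimately show ?thesis
    by (simp add: scaleR_add_right U_plus)
qed

section \<open>The closed subspace of vectors with vanishing averages\<close>

definition null_averages :: "real \<Rightarrow> real \<Rightarrow> (real \<Rightarrow> 'v) \<Rightarrow> 'h set"
  where "null_averages a b q
    = {x. ((\<lambda>l. LINT t:{a..b}|lborel. U (l *\<^sub>R q t) x) \<longlongrightarrow> 0) at_top}"

lemma subspace_null_averages:
  assumes "continuous_on {a..b} q"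
  shows "subspace (null_averages a b q)"
proof -
  have int: "set_integrable lborel {a..b} (\<lambda>t. U (l *\<^sub>R q t) x)" for l x
    by (intro set_integrable_U continuous_intros assms)
  show ?thesis
    unfolding subspace_def null_averages_def
  proof (intro conjI ballI allI; unfold mem_Collect_eq)
    show "((\<lambda>l. LINT t:{a..b}|lborel. U (l *\<^sub>R q t) 0) \<longlongrightarrow> 0) at_top"
      using U_scaleR[of _ 0 0] by simp
  next
    fix x y
    assume "((\<lambda>l. LINT t:{a..b}|lborel. U (l *\<^sub>R q t) x) \<longlongrightarrow> 0) at_top"
      and "((\<lambda>l. LINT t:{a..b}|lborel. U (l *\<^sub>R q t) y) \<longlongrightarrow> 0) at_top"
    from tendsto_add[OF this]
    show "((\<lambda>l. LINT t:{a..b}|lborel. U (l *\<^sub>R q t) (x + y)) \<longlongrightarrow> 0) at_top"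
      by (simp add: U_add set_integral_add int)
  next
    fix r x
    assume "((\<lambda>l. LINT t:{a..b}|lborel. U (l *\<^sub>R q t) x) \<longlongrightarrow> 0) at_top"
    from tendsto_scaleR[OF tendsto_const[of r] this]
    show "((\<lambda>l. LINT t:{a..b}|lborel. U (l *\<^sub>R q t) (r *\<^sub>R x)) \<longlongrightarrow> 0) at_top"
      by (simp add: U_scaleR)
  qed
qed

text \<open>Since \<open>U\<close> is isometric, the averaging operators are bounded uniformly in
  \<open>l\<close>, so convergence to 0 survives norm limits of vectors.\<close>

lemma closed_null_averages:
  assumes "continuous_on {a..b} q"
  shows "closed (null_averages a b q)"
proof (unfold closed_sequential_limits, intro allI impI, elim conjE)
  fix g x
  assume g: "\<forall>n. g n \<in> null_averages a b q" and lim: "g \<longlonglongrightarrow> x"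
  define A where "A l y = (LINT t:{a..b}|lborel. U (l *\<^sub>R q t) y)" for l y
  \<comment> \<open>Adding 1 keeps the bound positive for a degenerate interval, so that
    \<open>e / (2 * K)\<close> is a valid tolerance.\<close>
  define K where "K = max 0 (b - a) + 1"
  have K: "K > 0" by (simp add: K_def)
  have cont: "continuous_on {a..b} (\<lambda>t. l *\<^sub>R q t)" for l
    by (intro continuous_intros assms)
  have A_diff: "norm (A l (y - z)) \<le> K * norm (y - z)" "A l (y - z) = A l y - A l z" for l y z
  proof -
    show "A l (y - z) = A l y - A l z"
      by (simp add: A_def U_diff set_integral_diff set_integrable_U[OF cont])
    have "norm (A l (y - z)) \<le> max 0 (b - a) * norm (y - z)"
      unfolding A_def by (rule norm_integral_U_le[OF cont])
    also have "\<dots> \<le> K * norm (y - z)"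
      by (simp add: K_def algebra_simps)
    finally show "norm (A l (y - z)) \<le> K * norm (y - z)" .
  qed
  have "((\<lambda>l. A l x) \<longlongrightarrow> 0) at_top"
  proof (rule tendstoI)
    fix e :: real
    assume e: "e > 0"
    then obtain n where n: "dist (g n) x < e / (2 * K)"
      using lim K unfolding lim_sequentially by (meson divide_pos_pos mult_pos_pos order_refl zero_less_numeral)
    have "\<forall>\<^sub>F l in at_top. dist (A l (g n)) 0 < e / 2"
      using g e by (intro tendstoD) (auto simp: null_averages_def A_def)
    then show "\<forall>\<^sub>F l in at_top. dist (A l x) 0 < e"
    proof eventually_elim
      case (elim l)
      have "norm (A l x - A l (g n)) \<le> K * norm (x - g n)"
        using A_diff[of l x "g n"] by simp
      also have "\<dots> < e / 2"
        using n K by (simp add: dist_norm norm_minus_commute field_simps)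
      finally show ?case
        using elim norm_triangle_sub[of "A l x" "A l (g n)"] by (simp add: dist_norm)
    qed
  qed
  then show "x \<in> null_averages a b q"
    by (simp add: null_averages_def A_def)
qed

lemma coefficients_in_stab:
  assumes orth: "\<And>w. w \<in> null_averages a b (\<lambda>t. \<Sum>k\<le>D. t ^ k *\<^sub>R c k) \<Longrightarrow> rinner w z = 0"
    and "0 < k" and "k \<le> D"
  shows "c k \<in> stab z"
  using assms(2,3)
\<comment> \<open>Induction on the distance from the top degree makes the claim available for all
  larger indices.\<close>
proof (induction "D - k" arbitrary: k rule: less_induct)
  case less
  have IH: "c j \<in> stab z" if "k < j" "j \<le> D" for j
    using less.hyps[of j] less.prems that by simp
  have "U (s *\<^sub>R c k) z = z" for s
  proof -
    define w where "w = U (s *\<^sub>R c k) z - z"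
    \<comment> \<open>Positivity of \<open>k\<close> enters here: the averaging lemma concerns
      curves with a term of formal degree \<open>Suc d\<close>, so nothing is learned about
      \<open>c 0\<close>.\<close>
    obtain d where d: "k = Suc d"
      using less.prems(1) gr0_implies_Suc by blast
    \<comment> \<open>The operators commute, so whatever fixes \<open>z\<close> also fixes its
      coboundary \<open>w\<close>.\<close>
    have "v \<in> stab w" if "v \<in> stab z" for v
      using that by (simp add: stab_def w_def U_diff U_commute[of _ "s *\<^sub>R c k"])
    from fixed_by_stab_coefficients[OF this less.prems(2) IH]
    have "w \<in> null_averages a b (\<lambda>t. \<Sum>k\<le>D. t ^ k *\<^sub>R c k)"
      using average_coboundary_tendsto_0[where d = d and y = z and s = s and a = a and b = b and c = c]
      unfolding null_averages_def w_def[symmetric] d[symmetric] by (simp only: mem_Collect_eq)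
    \<comment> \<open>Both vectors have norm \<open>norm z\<close>, so this value of their inner
      product forces them to coincide.\<close>
    then have "rinner (U (s *\<^sub>R c k) z) z = (norm z)\<^sup>2"
      using orth[of w] by (simp add: w_def rinner_simps rinner_self)
    then have "(norm (U (s *\<^sub>R c k) z - z))\<^sup>2 = 0"
      unfolding norm_diff_square by (simp add: norm_U)
    then show ?thesis by simp
  qed
  then show ?case by (simp add: stab_def)
qed

end

section \<open>Vector coefficients of the curve and the conclusion\<close>

lemma polynomial_curve_coefficients:
  fixes p :: "real \<Rightarrow> real ^ 'n"
  assumes "polynomial_curve p"
  obtains D and c :: "nat \<Rightarrow> real ^ 'n" where "\<And>t. t \<in> {0..1} \<Longrightarrow> p t = (\<Sum>k\<le>D. t ^ k *\<^sub>R c k)"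
proof -
  obtain q :: "'n \<Rightarrow> real poly" where q: "\<And>i t. t \<in> {0..1} \<Longrightarrow> p t $ i = poly (q i) t"
    using assms unfolding polynomial_curve_def by metis
  \<comment> \<open>A common degree for the finitely many coordinate polynomials; shorter ones are
    padded with zero coefficients.\<close>
  define D where "D = Max (range (\<lambda>i. degree (q i)))"
  have D: "degree (q i) \<le> D" for i
    by (simp add: D_def)
  have "p t = (\<Sum>k\<le>D. t ^ k *\<^sub>R (\<chi> i. coeff (q i) k))" if "t \<in> {0..1}" for t
  proof -
    have "p t $ i = (\<Sum>k\<le>D. t ^ k * coeff (q i) k)" for i
      unfolding q[OF that] poly_altdef mult.commute[of "_ ^ _"]
      by (intro sum.mono_neutral_left) (use D in \<open>auto simp: coeff_eq_0 intro: order_trans\<close>)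
    then show ?thesis
      by (simp add: vec_eq_iff)
  qed
  then show ?thesis by (rule that)
qed

theorem theorem2:
  fixes U :: "real ^ 'n \<Rightarrow> 'h \<Rightarrow> 'h::{chilbert_space, second_countable_topology}"
    and p :: "real \<Rightarrow> real ^ 'n"
    and x :: 'h
  assumes "unitary_representation U"
    and "\<And>y. invariant_vector U y \<Longrightarrow> y = 0"
    and "polynomial_curve p"
    and "\<not> (\<exists>A. affine A \<and> A \<noteq> UNIV \<and> p ` {0..1} \<subseteq> A)"
  shows "((\<lambda>l. curve_average U p l x) \<longlongrightarrow> 0) at_top"
proof -
  interpret unitary_rep U
    by unfold_locales (rule assms(1))
  obtain D c where p: "\<And>t. t \<in> {0..1} \<Longrightarrow> p t = (\<Sum>k\<le>D. t ^ k *\<^sub>R c k)"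
    using polynomial_curve_coefficients[OF assms(3)] by blast
  define G where "G = null_averages 0 1 (\<lambda>t. \<Sum>k\<le>D. t ^ k *\<^sub>R c k)"
  have "closed G" "subspace G"
    unfolding G_def by (intro closed_null_averages subspace_null_averages continuous_intros)+
  have "G = UNIV"
  proof (rule ccontr)
    assume "G \<noteq> UNIV"
    then obtain z where "z \<noteq> 0" and z: "\<And>w. w \<in> G \<Longrightarrow> rinner w z = 0"
      using ex_orthogonal_vector[OF \<open>closed G\<close> \<open>subspace G\<close>] by blast
    have c: "c k \<in> stab z" if "0 < k" "k \<le> D" for k
      using coefficients_in_stab[OF z[unfolded G_def] that] .
    have "{..D} - {0} = {0<..D}" by auto
    \<comment> \<open>All coefficients except \<open>c 0\<close> lie in \<open>stab z\<close>, so
      the curve stays in a translate of that subspace. The hypothesis on \<open>p\<close> then makes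
      the translate, and hence \<open>stab z\<close>, the whole space.\<close>
    have "p t \<in> (+) (c 0) ` stab z" if "t \<in> {0..1}" for t
    proof
      show "p t = c 0 + (\<Sum>k\<in>{0<..D}. t ^ k *\<^sub>R c k)"
        using p[OF that] sum.remove[of "{..D}" 0 "\<lambda>k. t ^ k *\<^sub>R c k"] \<open>{..D} - {0} = {0<..D}\<close>
        by simp
      show "(\<Sum>k\<in>{0<..D}. t ^ k *\<^sub>R c k) \<in> stab z"
        by (intro subspace_sum subspace_scale subspace_stab) (simp add: c)
    qed
    moreover have "affine ((+) (c 0) ` stab z)"
      by (simp add: affine_translation[symmetric] subspace_imp_affine subspace_stab)
    ultimately have "(+) (c 0) ` stab z = UNIV"
      using assms(4) by blast
    then have "v \<in> stab z" for v
      by (metis UNIV_I add_left_cancel imageE)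
    then have "invariant_vector U z"
      unfolding invariant_vector_def stab_def by (metis (mono_tags) mem_Collect_eq scaleR_one)
    with assms(2) \<open>z \<noteq> 0\<close> show False by blast
  qed
  \<comment> \<open>The polynomial formula for \<open>p\<close> is available only on
    \<open>{0..1}\<close>, which suffices under the integral.\<close>
  moreover have "curve_average U p l x
      = (LINT t:{0..1}|lborel. U (l *\<^sub>R (\<Sum>k\<le>D. t ^ k *\<^sub>R c k)) x)" for l
    unfolding curve_average_def by (rule set_lebesgue_integral_cong) (auto simp: p)
  ultimately show ?thesis
    by (auto simp: G_def null_averages_def)
qed

end
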